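(* For $i=1,2$, let $u_i\in\mathbb{Q}\langle a,b\rangle$ be a homogeneous $ab$-polynomial that is an eigenvector with eigenvalue $\lambda_i$ of the linear operator $\mathcal{I}_2$. Then $M(u_1,u_2)$ is an eigenvector of $\mathcal{I}_2$ with eigenvalue $\lambda_1\cdot\lambda_2$.
   Context: $\mathbb{Q}\langle a,b\rangle$ is the free associative algebra on noncommuting variables $a,b$, with basis all $ab$-words, including the empty word $1$. The map $u\mapsto u^*$ is the linear map reversing each word: $(u_1\cdots u_n)^*=u_n\cdots u_1$. The coproduct $\Delta$ is the linear map with $\Delta(u)=\sum_{i=1}^n u_1\cdots u_{i-1}\otimes u_{i+1}\cdots u_n$ for an $ab$-word $u=u_1\cdots u_n$ (so $\Delta(1)=0$), written in Sweedler notation as $\Delta(u)=\sum_u u_{(1)}\otimes u_{(2)}$. The mixing operator $M$ is the bilinear operator on $\mathbb{Q}\langle a,b\rangle$ given by $$M(u,v)=\sum_{r=1}^2\sum_{s=1}^2\ \sum_{n\ge 2,\ n-r-s-1\text{ even}}M_{r,s,n}(u,v),$$ where the bilinear operators $M_{r,s,n}$ (needed only for $n-r-s-1$ even) are defined recursively by $M_{1,2,2}(u,v)=u\cdot a\cdot v$, $M_{2,1,2}(u,v)=v\cdot b\cdot u$, and for $n\ge 2$: $M_{1,s,n+1}(u,v)=\sum_u u_{(1)}\cdot a\cdot M_{2,s,n}(u_{(2)},v)$ and $M_{2,s,n+1}(u,v)=\sum_v v_{(1)}\cdot b\cdot M_{1,s,n}(u,v_{(2)})$. The linear operator $\mathcal{I}_2$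 on $\mathbb{Q}\langle a,b\rangle$ (the interval transform of the second kind at the level of $ab$-indices) is given on $ab$-words by $\mathcal{I}_2(u)=u+u^*+\sum_u M(u_{(1)}^*,u_{(2)})$. *)

theory Defs
  imports Complex_Main "HOL-Library.Poly_Mapping"
begin

section \<open>The free associative algebra on two noncommuting variables\<close>

datatype letter = A | B

text \<open>Words form a monoid under concatenation.  With this instance the product that
  Poly_Mapping puts on finitely supported functions is the convolution product, so that
  finitely supported functions from words to the rationals are the free associative algebra,
  with the empty word as its unit.\<close>

instantiation list :: (type) monoid_add
begin
definition zero_list :: "'a list" where "zero_list = []"
definition plus_list :: "'a list \<Rightarrow> 'a list \<Rightarrow> 'a list" where "plus_list = (@)"
instance by standard (simp_all add: zero_list_def plus_list_def)
end

type_synonym ab_word = "letter list"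
type_synonym ab_poly = "ab_word \<Rightarrow>\<^sub>0 rat"

text \<open>The tensor square, given by its basis of all elements \<open>x \<otimes> y\<close> with \<open>x\<close> and \<open>y\<close> words.\<close>

type_synonym ab_tensor = "(ab_word \<times> ab_word) \<Rightarrow>\<^sub>0 rat"

definition word :: "ab_word \<Rightarrow> ab_poly" where
  "word w = Poly_Mapping.single w 1"

definition tensor :: "ab_word \<Rightarrow> ab_word \<Rightarrow> ab_tensor" where
  "tensor x y = Poly_Mapping.single (x, y) 1"

definition scale :: "rat \<Rightarrow> ('k \<Rightarrow>\<^sub>0 rat) \<Rightarrow> ('k \<Rightarrow>\<^sub>0 rat)" where
  "scale c p = Poly_Mapping.map ((*) c) p"

definition lin_ext :: "('k \<Rightarrow> ('m \<Rightarrow>\<^sub>0 rat)) \<Rightarrow> ('k \<Rightarrow>\<^sub>0 rat) \<Rightarrow> ('m \<Rightarrow>\<^sub>0 rat)" where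
  "lin_ext f p = (\<Sum>k\<in>Poly_Mapping.keys p. scale (Poly_Mapping.lookup p k) (f k))"

definition homogeneous :: "ab_poly \<Rightarrow> bool" where
  "homogeneous u \<longleftrightarrow> (\<exists>d. \<forall>w\<in>Poly_Mapping.keys u. length w = d)"

definition eigenvector :: "(ab_poly \<Rightarrow> ab_poly) \<Rightarrow> rat \<Rightarrow> ab_poly \<Rightarrow> bool" where
  "eigenvector T c u \<longleftrightarrow> u \<noteq> 0 \<and> T u = scale c u"

section \<open>Reversal, coproduct, mixing operator, interval transform\<close>

definition star :: "ab_poly \<Rightarrow> ab_poly" where
  "star = lin_ext (\<lambda>w. word (rev w))"

definition coproduct :: "ab_poly \<Rightarrow> ab_tensor" where
  "coproduct = lin_ext (\<lambda>w. \<Sum>i<length w. tensor (take i w) (drop (Suc i) w))"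

text \<open>Sweedler notation: \<open>sweedler u F\<close> is the sum over \<open>u\<close> of \<open>F u\<^sub>(\<^sub>1\<^sub>) u\<^sub>(\<^sub>2\<^sub>)\<close>, that is,
  the linear map on the tensor square induced by the bilinear map \<open>F\<close>, applied to the
  coproduct of \<open>u\<close>.\<close>

definition sweedler :: "ab_poly \<Rightarrow> (ab_poly \<Rightarrow> ab_poly \<Rightarrow> ab_poly) \<Rightarrow> ab_poly" where
  "sweedler u F = lin_ext (\<lambda>(x, y). F (word x) (word y)) (coproduct u)"

text \<open>\<open>mix_part r s n\<close> is \<open>M\<^sub>r\<^sub>,\<^sub>s\<^sub>,\<^sub>n\<close>.  It is only meaningful for \<open>r, s \<in> {1, 2}\<close>, \<open>n \<ge> 2\<close> and
  \<open>n - r - s - 1\<close> even; the value 0 given to some other arguments is never used, because the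
  recursion preserves the parity of \<open>n - r - s - 1\<close>.\<close>

fun mix_part :: "nat \<Rightarrow> nat \<Rightarrow> nat \<Rightarrow> ab_poly \<Rightarrow> ab_poly \<Rightarrow> ab_poly" where
  "mix_part r s 0 u v = 0"
| "mix_part r s (Suc 0) u v = 0"
| "mix_part r s (Suc (Suc 0)) u v =
    (if r = 1 \<and> s = 2 then u * word [A] * v
     else if r = 2 \<and> s = 1 then v * word [B] * u
     else 0)"
| "mix_part r s (Suc (Suc (Suc n))) u v =
    (if r = 1 then sweedler u (\<lambda>u1 u2. u1 * word [A] * mix_part 2 s (Suc (Suc n)) u2 v)
     else if r = 2 then sweedler v (\<lambda>v1 v2. v1 * word [B] * mix_part 1 s (Suc (Suc n)) u v2)
     else 0)"

lemma mix_part_base: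
  "mix_part 1 2 2 u v = u * word [A] * v"
  "mix_part 2 1 2 u v = v * word [B] * u"
  by (simp_all add: numeral_2_eq_2)

lemma mix_part_rec:
  assumes "n \<ge> 2"
  shows "mix_part 1 s (n + 1) u v =
           sweedler u (\<lambda>u1 u2. u1 * word [A] * mix_part 2 s n u2 v)"
    and "mix_part 2 s (n + 1) u v =
           sweedler v (\<lambda>v1 v2. v1 * word [B] * mix_part 1 s n u v2)"
proof -
  obtain m where n: "n = Suc (Suc m)"
    using assms by (metis add_2_eq_Suc le_Suc_ex)
  show "mix_part 1 s (n + 1) u v =
           sweedler u (\<lambda>u1 u2. u1 * word [A] * mix_part 2 s n u2 v)"
    and "mix_part 2 s (n + 1) u v =
           sweedler v (\<lambda>v1 v2. v1 * word [B] * mix_part 1 s n u v2)"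
    by (simp_all add: n)
qed

text \<open>The sum over all \<open>n\<close> has only finitely many nonzero terms, see
  \<open>finite_mix_part_support\<close> below, so that \<^const>\<open>Sum_any\<close> is the intended sum.  The exponent
  \<open>n - r - s - 1\<close> may be negative, hence the integers in the parity condition.\<close>

definition mix :: "ab_poly \<Rightarrow> ab_poly \<Rightarrow> ab_poly" where
  "mix u v = (\<Sum>r\<in>{1..2}. \<Sum>s\<in>{1..2}.
     Sum_any (\<lambda>n. if n \<ge> 2 \<and> even (int n - int r - int s - 1) then mix_part r s n u v else 0))"

definition interval_transform2 :: "ab_poly \<Rightarrow> ab_poly" where
  "interval_transform2 =
     lin_ext (\<lambda>w. word w + star (word w) + sweedler (word w) (\<lambda>x y. mix (star x) y))"

section \<open>Basic facts\<close>

lemma lookup_scale [simp]: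
  "Poly_Mapping.lookup (scale c p) k = c * Poly_Mapping.lookup p k"
  by (simp add: scale_def Poly_Mapping.map.rep_eq when_def)

interpretation scale: vector_space "scale :: rat \<Rightarrow> ('k \<Rightarrow>\<^sub>0 rat) \<Rightarrow> ('k \<Rightarrow>\<^sub>0 rat)"
  by standard (rule poly_mapping_eqI; simp add: lookup_add algebra_simps)+

lemma lin_ext_superset:
  assumes "finite S" "Poly_Mapping.keys p \<subseteq> S"
  shows "lin_ext f p = (\<Sum>k\<in>S. scale (Poly_Mapping.lookup p k) (f k))"
  unfolding lin_ext_def
  by (rule sum.mono_neutral_left) (use assms in \<open>auto simp: in_keys_iff\<close>)

lemma linear_lin_ext: "Vector_Spaces.linear scale scale (lin_ext f)"
proof (unfold_locales, goal_cases)
  case (1 p q)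
  let ?S = "Poly_Mapping.keys p \<union> Poly_Mapping.keys q"
  have "lin_ext f (p + q) = (\<Sum>k\<in>?S. scale (Poly_Mapping.lookup (p + q) k) (f k))"
    by (rule lin_ext_superset) (use Poly_Mapping.keys_add[of p q] in auto)
  also have "\<dots> = lin_ext f p + lin_ext f q"
    by (simp add: lin_ext_superset[of ?S p] lin_ext_superset[of ?S q]
        lookup_add scale.scale_left_distrib sum.distrib)
  finally show ?case .
next
  case (2 c p)
  have "lin_ext f (scale c p)
      = (\<Sum>k\<in>Poly_Mapping.keys p. scale (Poly_Mapping.lookup (scale c p) k) (f k))"
    by (rule lin_ext_superset) (auto simp: in_keys_iff)
  also have "\<dots> = scale c (lin_ext f p)"
    by (simp add: lin_ext_def scale.scale_sum_right)
  finally show ?case .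
qed

lemma lin_ext_word: "lin_ext f (word w) = f w"
  by (simp add: lin_ext_def word_def)

lemma linear_interval_transform2: "Vector_Spaces.linear scale scale interval_transform2"
  unfolding interval_transform2_def by (rule linear_lin_ext)

lemma star_word: "star (word w) = word (rev w)"
  by (simp add: star_def lin_ext_word)

lemma coproduct_word:
  "coproduct (word w) = (\<Sum>i<length w. tensor (take i w) (drop (Suc i) w))"
  by (simp add: coproduct_def lin_ext_word)

lemma interval_transform2_word:
  "interval_transform2 (word w) =
     word w + star (word w) + sweedler (word w) (\<lambda>x y. mix (star x) y)"
  by (simp add: interval_transform2_def lin_ext_word)

lemma word_mult: "word x * word y = word (x @ y)"
  by (simp add: word_def mult_single plus_list_def)

lemma word_Nil: "word [] = 1"
  unfolding word_def zero_list_def[symmetric] by (rule single_one)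

lemma keys_sum_subset: "Poly_Mapping.keys (sum f S) \<subseteq> (\<Union>x\<in>S. Poly_Mapping.keys (f x))"
proof (induction S rule: infinite_finite_induct)
  case (insert x S)
  then show ?case
    using Poly_Mapping.keys_add[of "f x" "sum f S"] by auto
qed auto

lemma keys_coproduct:
  assumes "(x, y) \<in> Poly_Mapping.keys (coproduct u)"
  shows "\<exists>w\<in>Poly_Mapping.keys u. \<exists>l. w = x @ l # y"
proof -
  obtain w where w: "w \<in> Poly_Mapping.keys u"
    and "(x, y) \<in> Poly_Mapping.keys (scale (Poly_Mapping.lookup u w)
           (\<Sum>i<length w. tensor (take i w) (drop (Suc i) w)))"
    using assms keys_sum_subset unfolding coproduct_def lin_ext_def by fastforce
  then have "(x, y) \<in> Poly_Mapping.keys (\<Sum>i<length w. tensor (take i w) (drop (Suc i) w))"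
    by (auto simp: in_keys_iff)
  then obtain i where "i < length w" "x = take i w" "y = drop (Suc i) w"
    using keys_sum_subset[of "\<lambda>i. tensor (take i w) (drop (Suc i) w)" "{..<length w}"]
    by (auto simp: tensor_def)
  then have "w = x @ w ! i # y"
    using id_take_nth_drop by blast
  with w show ?thesis by blast
qed

lemma sweedler_eq_0:
  assumes "\<And>x y. (x, y) \<in> Poly_Mapping.keys (coproduct u) \<Longrightarrow> F (word x) (word y) = 0"
  shows "sweedler u F = 0"
  unfolding sweedler_def lin_ext_def
  by (rule sum.neutral) (use assms in auto)

lemma mix_part_eq_0:
  assumes "\<forall>w\<in>Poly_Mapping.keys u. length w < p" "\<forall>w\<in>Poly_Mapping.keys v. length w < q"
    and "p + q < n"
  shows "mix_part r s n u v = 0"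
  using assms
proof (induction r s n u v arbitrary: p q rule: mix_part.induct)
  case (3 r s u v)
  then have "p = 0 \<or> q = 0" by linarith
  then have "u = 0 \<or> v = 0" using 3 by auto
  then show ?case by auto
next
  case (4 r s n u v)
  have "mix_part 2 s (Suc (Suc n)) (word y) v = 0"
    if "r = 1" "(x, y) \<in> Poly_Mapping.keys (coproduct u)" for x y
  proof -
    have "length y < p - 1"
      using keys_coproduct[OF that(2)] "4.prems"(1) by fastforce
    then show ?thesis
      using "4.IH"(1)[OF that(1), where p = "p - 1" and q = q] "4.prems"(2,3) by (auto simp: word_def)
  qed
  moreover have "mix_part 1 s (Suc (Suc n)) u (word y) = 0"
    if "r = 2" "(x, y) \<in> Poly_Mapping.keys (coproduct v)" for x y
  proof -
    have "length y < q - 1"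
      using keys_coproduct[OF that(2)] "4.prems"(2) by fastforce
    then show ?thesis
      using "4.IH"(2)[OF _ that(1), where p = p and q = "q - 1"] that(1) "4.prems"(1,3) by (auto simp: word_def)
  qed
  ultimately show ?case
    by (auto intro!: sweedler_eq_0)
qed auto

lemma finite_mix_part_support: "finite {n. mix_part r s n u v \<noteq> 0}"
proof -
  have bd: "\<exists>p. \<forall>w\<in>Poly_Mapping.keys u. length w < p" for u :: ab_poly
    using finite_nat_set_iff_bounded[of "length ` Poly_Mapping.keys u"] by auto
  obtain p where p: "\<forall>w\<in>Poly_Mapping.keys u. length w < p"
    using bd by blast
  obtain q where q: "\<forall>w\<in>Poly_Mapping.keys v. length w < q"
    using bd by blast
  have "{n. mix_part r s n u v \<noteq> 0} \<subseteq> {..p + q}"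
    using mix_part_eq_0[OF p q] by (auto simp: not_less[symmetric])
  then show ?thesis
    using finite_subset by blast
qed

end

theory Submission
  imports Defs "HOL-Computational_Algebra.Polynomial"
begin

text \<open>Under \<open>a - b \<mapsto> t\<close> the monomials in \<open>t\<close> and \<open>b\<close> correspond to the monomial quasisymmetric
  functions: \<open>M\<close> becomes the product, \<open>u \<mapsto> u\<^sup>*\<close> the reversal and \<open>\<Delta>\<close> the reduced coproduct, so that
  \<open>\<I>\<^sub>2\<close> is the convolution of the reversal with the identity.  Evaluation at a list \<open>xs\<close> of rationals
  therefore turns \<open>M\<close> into multiplication and \<open>\<I>\<^sub>2\<close> into evaluation at \<open>rev xs @ xs\<close>, which makes
  \<open>\<I>\<^sub>2\<close> multiplicative with respect to \<open>M\<close>, because evaluations separate \<open>ab\<close>-polynomials.  As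
  quasisymmetric functions have no zero divisors, \<open>M(u\<^sub>1, u\<^sub>2) \<noteq> 0\<close>.\<close>

section \<open>Linear functionals\<close>

text \<open>The linear functional with values \<open>f\<close> on the basis. Pairing with such
  functionals reduces identities between multilinear operators to identities between functions of
  words.\<close>

definition pairing :: "('k \<Rightarrow> rat) \<Rightarrow> ('k \<Rightarrow>\<^sub>0 rat) \<Rightarrow> rat" where
  "pairing f p = (\<Sum>k\<in>Poly_Mapping.keys p. Poly_Mapping.lookup p k * f k)"

lemma pairing_superset:
  assumes "finite S" "Poly_Mapping.keys p \<subseteq> S"
  shows "pairing f p = (\<Sum>k\<in>S. Poly_Mapping.lookup p k * f k)"
  unfolding pairing_def
  by (rule sum.mono_neutral_left) (use assms in \<open>auto simp: in_keys_iff\<close>)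

lemma pairing_cong:
  assumes "\<And>k. k \<in> Poly_Mapping.keys p \<Longrightarrow> f k = g k"
  shows "pairing f p = pairing g p"
  unfolding pairing_def by (rule sum.cong) (use assms in auto)

lemma pairing_0 [simp]: "pairing f 0 = 0"
  by (simp add: pairing_def)

lemma pairing_zero_fun [simp]: "pairing (\<lambda>k. 0) p = 0"
  by (simp add: pairing_def)

lemma pairing_single [simp]: "pairing f (Poly_Mapping.single k c) = c * f k"
  by (simp add: pairing_def)

lemma pairing_word [simp]: "pairing f (word w) = f w"
  by (simp add: word_def)

lemma pairing_add: "pairing f (p + q) = pairing f p + pairing f q"
proof -
  let ?S = "Poly_Mapping.keys p \<union> Poly_Mapping.keys q"
  have "pairing f (p + q) = (\<Sum>k\<in>?S. Poly_Mapping.lookup (p + q) k * f k)"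
    by (rule pairing_superset) (use Poly_Mapping.keys_add[of p q] in auto)
  then show ?thesis
    by (simp add: pairing_superset[of ?S p] pairing_superset[of ?S q]
        lookup_add distrib_right sum.distrib)
qed

lemma pairing_diff: "pairing f (p - q) = pairing f p - pairing f q"
  using pairing_add[of f "p - q" q] by simp

lemma pairing_scale: "pairing f (scale c p) = c * pairing f p"
proof -
  have "pairing f (scale c p)
      = (\<Sum>k\<in>Poly_Mapping.keys p. Poly_Mapping.lookup (scale c p) k * f k)"
    by (rule pairing_superset) (auto simp: in_keys_iff)
  then show ?thesis by (simp add: pairing_def sum_distrib_left mult.assoc)
qed

lemma pairing_sum: "pairing f (sum g S) = (\<Sum>x\<in>S. pairing f (g x))"
  by (induction S rule: infinite_finite_induct) (simp_all add: pairing_add)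

lemma pairing_lin_ext: "pairing f (lin_ext g p) = pairing (\<lambda>k. pairing f (g k)) p"
  unfolding lin_ext_def by (simp add: pairing_sum pairing_scale) (simp add: pairing_def)

lemma pairing_fun_add: "pairing (\<lambda>k. f k + g k) p = pairing f p + pairing g p"
  by (simp add: pairing_def distrib_left sum.distrib)

lemma pairing_fun_mult_left: "pairing (\<lambda>k. c * f k) p = c * pairing f p"
  by (simp add: pairing_def sum_distrib_left mult.left_commute)

lemma pairing_fun_mult_right: "pairing (\<lambda>k. f k * c) p = pairing f p * c"
  by (simp add: pairing_def sum_distrib_right mult.assoc)

lemma pairing_fun_sum: "pairing (\<lambda>k. \<Sum>x\<in>S. f x k) p = (\<Sum>x\<in>S. pairing (f x) p)"
  by (induction S rule: infinite_finite_induct) (simp_all add: pairing_fun_add)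

lemma pairing_swap:
  "pairing (\<lambda>x. pairing (f x) q) p = pairing (\<lambda>y. pairing (\<lambda>x. f x y) p) q"
proof -
  have "pairing (\<lambda>x. pairing (f x) q) p
      = (\<Sum>x\<in>Poly_Mapping.keys p. \<Sum>y\<in>Poly_Mapping.keys q.
          Poly_Mapping.lookup p x * (Poly_Mapping.lookup q y * f x y))"
    by (simp add: pairing_def sum_distrib_left)
  also have "\<dots> = (\<Sum>y\<in>Poly_Mapping.keys q. \<Sum>x\<in>Poly_Mapping.keys p.
          Poly_Mapping.lookup q y * (Poly_Mapping.lookup p x * f x y))"
    by (subst sum.swap) (simp add: mult.left_commute)
  also have "\<dots> = pairing (\<lambda>y. pairing (\<lambda>x. f x y) p) q"
    by (simp add: pairing_def sum_distrib_left)
  finally show ?thesis .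
qed

lemma pairing_indicator: "pairing (\<lambda>k. of_bool (k = y)) p = Poly_Mapping.lookup p y"
proof -
  have "pairing (\<lambda>k. of_bool (k = y)) p
      = (\<Sum>k\<in>insert y (Poly_Mapping.keys p). Poly_Mapping.lookup p k * of_bool (k = y))"
    by (rule pairing_superset) auto
  also have "\<dots> = Poly_Mapping.lookup p y"
    by (subst sum.remove[of _ y]) auto
  finally show ?thesis .
qed

lemma poly_mapping_add_induct [case_names single add]:
  fixes p :: "'a \<Rightarrow>\<^sub>0 'b::comm_monoid_add"
  assumes single: "\<And>k c. P (Poly_Mapping.single k c)"
    and add: "\<And>p q. P p \<Longrightarrow> P q \<Longrightarrow> P (p + q)"
  shows "P p"
proof -
  have "P (\<Sum>k\<in>S. Poly_Mapping.single k (Poly_Mapping.lookup p k))" for S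
    by (induction S rule: infinite_finite_induct) (use single[of _ 0] in \<open>simp_all add: assms\<close>)
  moreover have "(\<Sum>k\<in>Poly_Mapping.keys p. Poly_Mapping.single k (Poly_Mapping.lookup p k)) = p"
    by (rule poly_mapping_eqI)
      (auto simp: lookup_sum lookup_single when_def in_keys_iff if_distrib)
  ultimately show ?thesis by metis
qed

lemma pairing_mult:
  fixes p q :: ab_poly
  shows "pairing f (p * q) = pairing (\<lambda>x. pairing (\<lambda>y. f (x @ y)) q) p"
proof (induction p rule: poly_mapping_add_induct)
  case (single k c)
  show ?case
    by (induction q rule: poly_mapping_add_induct)
      (simp_all add: mult_single plus_list_def algebra_simps pairing_add)
next
  case (add p p')
  then show ?case by (simp add: distrib_right pairing_add)
qed

section \<open>Sums over the terms of the coproduct of a word\<close>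

text \<open>Values lie in any commutative monoid because polynomials are needed later as well as
  rationals.\<close>

definition split_sum :: "('a list \<Rightarrow> 'a list \<Rightarrow> 'b::comm_monoid_add) \<Rightarrow> 'a list \<Rightarrow> 'b" where
  "split_sum h w = (\<Sum>i<length w. h (take i w) (drop (Suc i) w))"

lemma split_sum_Nil [simp]: "split_sum h [] = 0"
  by (simp add: split_sum_def)

lemma split_sum_Cons [simp]: "split_sum h (l # w) = h [] w + split_sum (\<lambda>p. h (l # p)) w"
  by (simp add: split_sum_def sum.lessThan_Suc_shift del: sum.lessThan_Suc)

lemma split_sum_add: "split_sum (\<lambda>p q. h p q + k p q) w = split_sum h w + split_sum k w"
  by (simp add: split_sum_def sum.distrib)

lemma split_sum_zero [simp]: "split_sum (\<lambda>p q. 0) w = 0"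
  by (simp add: split_sum_def)

lemma split_sum_mult_left:
  "split_sum (\<lambda>p q. c * h p q) w = (c :: 'b :: semiring_0) * split_sum h w"
  by (simp add: split_sum_def sum_distrib_left)

lemma split_sum_mult_right:
  "split_sum (\<lambda>p q. h p q * c) w = split_sum h w * (c :: 'b :: semiring_0)"
  by (simp add: split_sum_def sum_distrib_right)

lemma split_sum_sum:
  "split_sum (\<lambda>p q. \<Sum>x\<in>S. h x p q) w = (\<Sum>x\<in>S. split_sum (h x) w)"
  unfolding split_sum_def by (rule sum.swap)

lemma split_sum_cong:
  assumes "\<And>p l q. w = p @ l # q \<Longrightarrow> h p q = k p q"
  shows "split_sum h w = split_sum k w"
  unfolding split_sum_def by (rule sum.cong) (auto intro: assms id_take_nth_drop)

lemma split_sum_append: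
  "split_sum h (u @ l # v) = h u v + split_sum (\<lambda>p q. h p (q @ l # v)) u
     + split_sum (\<lambda>p. h (u @ l # p)) v"
  by (induction u arbitrary: h) (simp_all add: add_ac)

lemma split_sum_rev: "split_sum h (rev w) = split_sum (\<lambda>p q. h (rev q) (rev p)) w"
  by (induction w arbitrary: h) (simp_all add: split_sum_append add_ac)

text \<open>Both sides run over the ways to delete two letters of \<open>w\<close>, cutting it into
  three words.\<close>

lemma split_sum_coassoc:
  "split_sum (\<lambda>p. split_sum (h p)) w = split_sum (\<lambda>p q. split_sum (\<lambda>x y. h x y q) p) w"
  by (induction w arbitrary: h) (simp_all add: split_sum_add add_ac)

lemma pairing_split_sum:
  "pairing (\<lambda>y. split_sum (\<lambda>p q. f p q y) w) v = split_sum (\<lambda>p q. pairing (f p q) v) w"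
  by (simp add: split_sum_def pairing_fun_sum)

lemma pairing_sweedler:
  "pairing f (sweedler u F) = pairing (split_sum (\<lambda>x y. pairing f (F (word x) (word y)))) u"
  unfolding sweedler_def coproduct_def
  by (simp add: pairing_lin_ext pairing_sum tensor_def split_sum_def[abs_def])

section \<open>The mixing operator on words\<close>

text \<open>\<open>mixA f u v\<close> and \<open>mixB f u v\<close> are the values of the functional \<open>f\<close> on the parts of
  \<open>M(u, v)\<close> with \<open>r = 1\<close> and \<open>r = 2\<close>.  The recursion goes letter by letter: the next letter of
  the current word is either copied, or deleted and replaced by the switch to the other word.\<close>

function mixA mixB :: "(ab_word \<Rightarrow> 'b::comm_monoid_add) \<Rightarrow> ab_word \<Rightarrow> ab_word \<Rightarrow> 'b" where
  "mixA f [] v = f (A # v)"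
| "mixA f (l # u) v = mixA (\<lambda>w. f (l # w)) u v + mixB (\<lambda>w. f (A # w)) u v"
| "mixB f u [] = f (B # u)"
| "mixB f u (l # v) = mixB (\<lambda>w. f (l # w)) u v + mixA (\<lambda>w. f (B # w)) u v"
  by pat_completeness auto
termination
  by (relation "measure (\<lambda>x. case x of Inl (f, u, v) \<Rightarrow> length u + length v
                                     | Inr (f, u, v) \<Rightarrow> length u + length v)") auto

abbreviation mixAB :: "(ab_word \<Rightarrow> 'b::comm_monoid_add) \<Rightarrow> ab_word \<Rightarrow> ab_word \<Rightarrow> 'b" where
  "mixAB f u v \<equiv> mixA f u v + mixB f u v"

lemma mixA_mixB_add:
  "mixA (\<lambda>w. f w + g w) u v = mixA f u v + mixA g u v"
  "mixB (\<lambda>w. f w + g w) u v = mixB f u v + mixB g u v"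
  by (induction f u v and f u v arbitrary: g and g rule: mixA_mixB.induct)
    (simp_all, simp_all add: add_ac)

lemma mixA_mixB_zero [simp]:
  "mixA (\<lambda>w. 0 :: 'b::comm_monoid_add) u v = 0" "mixB (\<lambda>w. 0 :: 'b) u v = 0"
proof -
  have "f = (\<lambda>w. 0) \<Longrightarrow> mixA f u v = 0" "f = (\<lambda>w. 0) \<Longrightarrow> mixB f u v = 0"
    for f :: "ab_word \<Rightarrow> 'b"
    by (induction f u v and f u v rule: mixA_mixB.induct) simp_all
  then show "mixA (\<lambda>w. 0 :: 'b) u v = 0" "mixB (\<lambda>w. 0 :: 'b) u v = 0"
    by simp_all
qed

lemma mixA_mixB_mult_right:
  fixes c :: "'b :: semiring_0"
  shows "mixA (\<lambda>w. f w * c) u v = mixA f u v * c" "mixB (\<lambda>w. f w * c) u v = mixB f u v * c"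
  by (induction f u v and f u v rule: mixA_mixB.induct) (simp_all add: distrib_right)

lemma mixA_mixB_mult_left:
  fixes c :: "'b :: semiring_0"
  shows "mixA (\<lambda>w. c * f w) u v = c * mixA f u v" "mixB (\<lambda>w. c * f w) u v = c * mixB f u v"
  by (induction f u v and f u v rule: mixA_mixB.induct) (simp_all add: distrib_left)

text \<open>Unrolling the letter recursion up to the first switch: \<open>u\<close> is copied to its
  end, or one of its letters is replaced by a switch to \<open>v\<close>. This is the recursion of
  \<open>mix_part\<close>, summed over the number of pieces.\<close>

lemma mixA_pieces:
  "mixA f u v = f (u @ A # v) + split_sum (\<lambda>x y. mixB (\<lambda>w. f (x @ A # w)) y v) u"
  by (induction u arbitrary: f) (simp_all add: add_ac)

lemma mixB_pieces:
  "mixB f u v = f (v @ B # u) + split_sum (\<lambda>x y. mixA (\<lambda>w. f (x @ B # w)) u y) v"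
  by (induction v arbitrary: f) (simp_all add: add_ac)

text \<open>Together these say that \<open>\<Delta>(M(u, v))\<close> is the product of the coproducts of \<open>u\<close> and \<open>v\<close>
  once a formal unit of the product \<open>M\<close> has been adjoined.\<close>

lemma mixA_mixB_split_sum:
  "mixA (split_sum h) u v = h u v + split_sum (\<lambda>x y. mixAB (h x) y v) u
     + split_sum (\<lambda>x y. mixA (\<lambda>p. h p y) u x) v
     + split_sum (\<lambda>x y. mixA (\<lambda>p. h p y) x v) u
     + split_sum (\<lambda>x y. split_sum (\<lambda>x' y'. mixA (\<lambda>p. mixAB (h p) y y') x x') v) u"
  "mixB (split_sum h) u v = h v u + split_sum (\<lambda>x y. mixAB (h x) u y) v
     + split_sum (\<lambda>x y. mixB (\<lambda>p. h p y) x v) u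
     + split_sum (\<lambda>x y. mixB (\<lambda>p. h p y) u x) v
     + split_sum (\<lambda>x y. split_sum (\<lambda>x' y'. mixB (\<lambda>p. mixAB (h p) y y') x x') v) u"
proof (induction "length u + length v" arbitrary: h u v rule: less_induct)
  case less
  {
    case 1
    show ?case
    proof (cases u)
      case Nil
      then show ?thesis by simp
    next
      case (Cons l u')
      \<comment> \<open>The prefix \<open>l\<close> belongs to copying the first letter, the prefix
        \<open>A\<close> to switching.\<close>
      then show ?thesis
        using less(1)[of u' v "\<lambda>p. h (l # p)"] less(2)[of u' v "\<lambda>p. h (A # p)"]
        by (simp add: mixA_mixB_add split_sum_add add_ac)
    qed
  next
    case 2
    show ?case
    proof (cases v)
      case Nil
      then show ?thesis by simp
    next
      case (Cons l v')
      then show ?thesis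
        using less(2)[of u v' "\<lambda>p. h (l # p)"] less(1)[of u v' "\<lambda>p. h (B # p)"]
        by (simp add: mixA_mixB_add split_sum_add add_ac)
    qed
  }
qed

section \<open>Evaluation of quasisymmetric functions\<close>

text \<open>\<open>evalq xs w\<close> is the fundamental quasisymmetric function of \<open>w\<close> at \<open>xs\<close>: the sum of
  \<open>x\<^bsub>i\<^sub>0\<^esub> \<cdots> x\<^bsub>i\<^sub>n\<^esub>\<close> over \<open>i\<^sub>0 \<le> \<cdots> \<le> i\<^sub>n\<close>, where \<open>n\<close> is the length of \<open>w\<close> and the inequality at
  each letter \<open>B\<close> is strict.\<close>

definition eval1 :: "'b::comm_ring_1 \<Rightarrow> ab_word \<Rightarrow> 'b" where
  "eval1 x w = (if B \<in> set w then 0 else x ^ Suc (length w))"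

fun evalq :: "'b::comm_ring_1 list \<Rightarrow> ab_word \<Rightarrow> 'b" where
  "evalq [] w = 0"
| "evalq (x # xs) w = eval1 x w + evalq xs w + split_sum (\<lambda>p q. eval1 x p * evalq xs q) w"

text \<open>Cut each index chain where it passes from \<open>xs\<close> to \<open>ys\<close>. The
  letter there is deleted, since its inequality, weak or strict, holds automatically.
  Coassociativity carries this through the recursion.\<close>

lemma evalq_append:
  "evalq (xs @ ys) w = evalq xs w + evalq ys w + split_sum (\<lambda>p q. evalq xs p * evalq ys q) w"
proof (induction xs arbitrary: w)
  case (Cons x xs)
  show ?case
    by (simp add: Cons split_sum_add distrib_left distrib_right split_sum_mult_left[symmetric]
        split_sum_mult_right[symmetric] split_sum_coassoc mult.assoc add_ac)
qed simp

lemma eval1_rev: "eval1 x (rev w) = eval1 x w"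
  by (simp add: eval1_def)

lemma evalq_rev: "evalq (rev xs) w = evalq xs (rev w)"
  by (induction xs arbitrary: w)
    (simp_all add: evalq_append split_sum_rev eval1_rev mult.commute add_ac)

text \<open>Leaving \<open>v\<close> always inserts a \<open>B\<close>, so every word produced by
  \<open>mixB\<close> contains one.\<close>

lemma mixB_eq_0:
  assumes "\<And>w. B \<in> set w \<Longrightarrow> f w = 0"
  shows "mixB f u v = 0"
  using assms
proof (induction v arbitrary: f)
  case (Cons l v)
  then have "(\<lambda>w. f (B # w)) = (\<lambda>w. 0)" by auto
  with Cons show ?case by simp
qed simp

lemma mixAB_eval1: "mixAB (eval1 x) u v = eval1 x u * eval1 x v"
proof -
  have "mixB (\<lambda>w. eval1 x (p @ A # w)) y v = 0" for p y
    by (rule mixB_eq_0) (simp add: eval1_def)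
  moreover have "mixB (eval1 x) u v = 0"
    by (rule mixB_eq_0) (simp add: eval1_def)
  moreover have "eval1 x (u @ A # v) = eval1 x u * eval1 x v"
    by (simp add: eval1_def power_add)
  ultimately show ?thesis by (simp add: mixA_pieces)
qed

text \<open>Once units are adjoined, \<open>evalq (x # xs)\<close> is the convolution of
  \<open>eval1 x\<close> and \<open>evalq xs\<close>. Both are multiplicative, and so is the
  coproduct by \<open>mixA_mixB_split_sum\<close>; hence so is the convolution.\<close>

lemma mixAB_evalq: "mixAB (evalq xs) u v = evalq xs u * evalq xs v"
proof (induction xs arbitrary: u v)
  case Nil
  have "evalq [] = (\<lambda>w. 0 :: 'a)" by auto
  then show ?case by simp
next
  case (Cons x xs)
  let ?f = "eval1 x" and ?g = "evalq xs"
  have *: "evalq (x # xs) = (\<lambda>w. ?f w + ?g w + split_sum (\<lambda>p q. ?f p * ?g q) w)"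
    by auto
  have g: "mixA (\<lambda>w. c * ?g w) y z + mixB (\<lambda>w. c * ?g w) y z = c * (?g y * ?g z)" for c y z
    by (simp add: mixA_mixB_mult_left distrib_left[symmetric] Cons)
  have f: "mixA (\<lambda>w. ?f w * c) y z + mixB (\<lambda>w. ?f w * c) y z = ?f y * ?f z * c" for c y z
    by (simp add: mixA_mixB_mult_right distrib_right[symmetric] mixAB_eval1)
  let ?S = "split_sum (\<lambda>p q. ?f p * ?g q)"
  have S: "split_sum (\<lambda>x y. split_sum (\<lambda>x' y'. ?f x * ?f x' * (?g y * ?g y')) v) u = ?S u * ?S v"
  proof -
    have "?f a * ?f a' * (?g b * ?g b') = (?f a * ?g b) * (?f a' * ?g b')" for a a' b b'
      by (simp add: mult_ac)
    then show ?thesis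
      by (simp only: split_sum_mult_left split_sum_mult_right)
  qed
  \<comment> \<open>These seven terms are all products of \<open>?f u + ?g u + ?S u\<close> with
    \<open>?f v + ?g v + ?S v\<close> except \<open>?f u * ?f v\<close> and
    \<open>?g u * ?g v\<close>.\<close>
  have "mixAB ?S u v = ?f u * ?g v + ?f v * ?g u
     + split_sum (\<lambda>x y. ?f x * (?g y * ?g v)) u
     + split_sum (\<lambda>x y. ?f x * (?g u * ?g y)) v
     + split_sum (\<lambda>x y. ?f u * ?f x * ?g y) v
     + split_sum (\<lambda>x y. ?f x * ?f v * ?g y) u
     + split_sum (\<lambda>x y. split_sum (\<lambda>x' y'. ?f x * ?f x' * (?g y * ?g y')) v) u"
    unfolding mixA_mixB_split_sum g
    by (simp add: f[symmetric] split_sum_add add_ac)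
  also have "\<dots> = ?f u * ?g v + ?f v * ?g u + ?S u * ?g v + ?g u * ?S v + ?f u * ?S v
     + ?f v * ?S u + ?S u * ?S v"
    unfolding S by (simp add: split_sum_mult_left[symmetric] split_sum_mult_right[symmetric] mult_ac)
  finally have "mixAB ?S u v = \<dots>" .
  moreover have "mixAB (evalq (x # xs)) u v = mixAB ?f u v + mixAB ?g u v + mixAB ?S u v"
    unfolding * mixA_mixB_add by (simp add: add_ac)
  ultimately have "mixAB (evalq (x # xs)) u v
      = (?f u + ?g u + ?S u) * (?f v + ?g v + ?S v)"
    unfolding mixAB_eval1 Cons by (simp only: algebra_simps)
  then show ?case
    unfolding evalq.simps(2)[of x xs u] evalq.simps(2)[of x xs v] .
qed


section \<open>The mixing operator and the interval transform under linear functionals\<close>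

lemma sum_1_2: "(\<Sum>i\<in>{1..2}. F i) = F 1 + F (2 :: nat)"
  by (simp add: numeral_2_eq_2)

text \<open>For given \<open>r\<close> and \<open>n\<close> parity admits exactly one
  \<open>s\<close>, so each number of pieces counts once. Each piece beyond two costs a letter,
  hence the bound on the lengths.\<close>

lemma pairing_mix_part:
  assumes "\<And>x y. x \<in> Poly_Mapping.keys u \<Longrightarrow> y \<in> Poly_Mapping.keys v \<Longrightarrow> length x + length y + 2 \<le> N"
  shows "(\<Sum>s\<in>{1..2}. \<Sum>n\<in>{2..N}. if even (int n - int 1 - int s - 1)
            then pairing f (mix_part 1 s n u v) else 0)
           = pairing (\<lambda>x. pairing (mixA f x) v) u" (is "?SA f N u v = _")
    and "(\<Sum>s\<in>{1..2}. \<Sum>n\<in>{2..N}. if even (int n - int 2 - int s - 1)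
            then pairing f (mix_part 2 s n u v) else 0)
           = pairing (\<lambda>x. pairing (mixB f x) v) u" (is "?SB f N u v = _")
proof -
  let ?SA = "\<lambda>f N u v. \<Sum>s\<in>{1..2}. \<Sum>n\<in>{2..N}. if even (int n - int 1 - int s - 1)
            then pairing f (mix_part 1 s n u v) else 0"
  let ?SB = "\<lambda>f N u v. \<Sum>s\<in>{1..2}. \<Sum>n\<in>{2..N}. if even (int n - int 2 - int s - 1)
            then pairing f (mix_part 2 s n u v) else 0"
  have "?SA f N u v = pairing (\<lambda>x. pairing (mixA f x) v) u \<and>
        ?SB f N u v = pairing (\<lambda>x. pairing (mixB f x) v) u"
    using assms
  proof (induction N arbitrary: f u v)
    case 0
    then have "u = 0 \<or> v = 0"
      by (metis all_not_in_conv keys_eq_empty le_zero_eq add_is_0 zero_neq_numeral)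
    then show ?case by auto
  next
    case (Suc N)
    show ?case
    proof (cases "N = 0")
      \<comment> \<open>The bound is 1 here, but any pair of words needs at least 2.\<close>
      case True
      then have "u = 0 \<or> v = 0"
        using Suc.prems by (metis all_not_in_conv keys_eq_empty not_less_eq_eq add_2_eq_Suc' le_zero_eq nat.distinct(1) le_SucE le_add2 le_trans)
      then show ?thesis using True by auto
    next
      case False
      have shift: "(\<Sum>n\<in>{2..Suc N}. F n) = F 2 + (\<Sum>n\<in>{2..N}. F (Suc n))" for F :: "nat \<Rightarrow> rat"
        using False sum.atLeast_Suc_atMost[of 2 "Suc N" F]
          sum.shift_bounds_cl_Suc_ivl[of F 2 N]
        by (simp del: sum.cl_ivl_Suc)
      have recA: "pairing f (mix_part 1 s (Suc n) u v) = pairing (split_sum (\<lambda>x y.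
          pairing (\<lambda>w. f (x @ A # w)) (mix_part 2 s n (word y) v))) u" if "n \<ge> 2" for n s
        using mix_part_rec(1)[OF that, of s u v]
        by (simp add: pairing_sweedler pairing_mult)
      have recB: "pairing f (mix_part 2 s (Suc n) u v) = pairing (split_sum (\<lambda>x y.
          pairing (\<lambda>w. f (x @ B # w)) (mix_part 1 s n u (word y)))) v" if "n \<ge> 2" for n s
        using mix_part_rec(2)[OF that, of s u v]
        by (simp add: pairing_sweedler pairing_mult)
      \<comment> \<open>Parity leaves only \<open>s = 2\<close> at \<open>n = 2\<close>. Raising
        \<open>n\<close> by one has the same effect on parity as exchanging \<open>r = 1\<close> and
        \<open>r = 2\<close>.\<close>
      have "?SA f (Suc N) u v = pairing f (u * word [A] * v) + (\<Sum>s\<in>{1..2}. \<Sum>n\<in>{2..N}.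
          if even (int n - int 2 - int s - 1) then pairing f (mix_part 1 s (Suc n) u v) else 0)"
        unfolding sum_1_2 shift
        by (simp add: mix_part_base mix_part_base[simplified] del: sum.cl_ivl_Suc)
      also have "\<dots> = pairing f (u * word [A] * v) + (\<Sum>s\<in>{1..2}. \<Sum>n\<in>{2..N}.
          pairing (split_sum (\<lambda>x y. if even (int n - int 2 - int s - 1)
            then pairing (\<lambda>w. f (x @ A # w)) (mix_part 2 s n (word y) v) else 0)) u)"
        using recA by (intro arg_cong2[where f = "(+)"] sum.cong refl)
            (auto simp: split_sum_zero[abs_def])
      also have "\<dots> = pairing f (u * word [A] * v)
          + pairing (split_sum (\<lambda>x y. ?SB (\<lambda>w. f (x @ A # w)) N (word y) v)) u"
        by (simp only: split_sum_sum[abs_def] pairing_fun_sum)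
      also have "\<dots> = pairing f (u * word [A] * v)
          + pairing (split_sum (\<lambda>x y. pairing (mixB (\<lambda>w. f (x @ A # w)) y) v)) u"
      proof -
        \<comment> \<open>Deleting \<open>l\<close> shortens the word, so the smaller bound
          \<open>N\<close> covers \<open>y\<close>.\<close>
        have "?SB (\<lambda>w. f (x @ A # w)) N (word y) v = pairing (mixB (\<lambda>w. f (x @ A # w)) y) v"
          if "x @ l # y \<in> Poly_Mapping.keys u" for x l y
          using Suc.IH[of "word y" v "\<lambda>w. f (x @ A # w)"] Suc.prems[OF that]
          by (fastforce simp: word_def)
        then show ?thesis
          by (intro arg_cong2[where f = "(+)"] refl pairing_cong split_sum_cong) auto
      qed
      also have "\<dots> = pairing (\<lambda>x. pairing (mixA f x) v) u"
        by (simp add: mixA_pieces[abs_def] pairing_mult pairing_fun_add pairing_split_sum)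
      finally have A: "?SA f (Suc N) u v = pairing (\<lambda>x. pairing (mixA f x) v) u" .
      have "?SB f (Suc N) u v = pairing f (v * word [B] * u) + (\<Sum>s\<in>{1..2}. \<Sum>n\<in>{2..N}.
          if even (int n - int 1 - int s - 1) then pairing f (mix_part 2 s (Suc n) u v) else 0)"
        unfolding sum_1_2 shift
        by (simp add: mix_part_base mix_part_base[simplified] del: sum.cl_ivl_Suc)
      also have "\<dots> = pairing f (v * word [B] * u) + (\<Sum>s\<in>{1..2}. \<Sum>n\<in>{2..N}.
          pairing (split_sum (\<lambda>x y. if even (int n - int 1 - int s - 1)
            then pairing (\<lambda>w. f (x @ B # w)) (mix_part 1 s n u (word y)) else 0)) v)"
        using recB by (intro arg_cong2[where f = "(+)"] sum.cong refl)
            (auto simp: split_sum_zero[abs_def])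
      also have "\<dots> = pairing f (v * word [B] * u)
          + pairing (split_sum (\<lambda>x y. ?SA (\<lambda>w. f (x @ B # w)) N u (word y))) v"
        by (simp only: split_sum_sum[abs_def] pairing_fun_sum)
      also have "\<dots> = pairing f (v * word [B] * u)
          + pairing (split_sum (\<lambda>x y. pairing (\<lambda>z. mixA (\<lambda>w. f (x @ B # w)) z y) u)) v"
      proof -
        have "?SA (\<lambda>w. f (x @ B # w)) N u (word y) = pairing (\<lambda>z. mixA (\<lambda>w. f (x @ B # w)) z y) u"
          if "x @ l # y \<in> Poly_Mapping.keys v" for x l y
          using Suc.IH[of u "word y" "\<lambda>w. f (x @ B # w)"] Suc.prems[OF _ that]
          by (fastforce simp: word_def)
        then show ?thesis
          by (intro arg_cong2[where f = "(+)"] refl pairing_cong split_sum_cong) auto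
      qed
      also have "\<dots> = pairing (\<lambda>y. pairing (\<lambda>x. mixB f x y) u) v"
        by (simp add: mixB_pieces[abs_def] pairing_mult pairing_fun_add pairing_split_sum)
      \<comment> \<open>\<open>mixB\<close> advances along \<open>v\<close>, so the two pairings
        arose in the opposite order.\<close>
      also have "\<dots> = pairing (\<lambda>x. pairing (mixB f x) v) u"
        by (rule pairing_swap[symmetric])
      finally show ?thesis using A by blast
    qed
  qed
  then show "?SA f N u v = pairing (\<lambda>x. pairing (mixA f x) v) u"
    and "?SB f N u v = pairing (\<lambda>x. pairing (mixB f x) v) u"
    by blast+
qed

lemma pairing_mix: "pairing f (mix u v) = pairing (\<lambda>x. pairing (mixAB f x) v) u"
proof -
  obtain p where p: "\<forall>w\<in>Poly_Mapping.keys u. length w < p"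
    using finite_nat_set_iff_bounded[of "length ` Poly_Mapping.keys u"] by auto
  obtain q where q: "\<forall>w\<in>Poly_Mapping.keys v. length w < q"
    using finite_nat_set_iff_bounded[of "length ` Poly_Mapping.keys v"] by auto
  have any: "Sum_any (\<lambda>n. if n \<ge> 2 \<and> even (int n - int r - int s - 1) then mix_part r s n u v else 0)
      = (\<Sum>n\<in>{2..p + q}. if even (int n - int r - int s - 1) then mix_part r s n u v else 0)"
    for r s
  proof -
    have "{n. (if n \<ge> 2 \<and> even (int n - int r - int s - 1) then mix_part r s n u v else 0) \<noteq> 0}
        \<subseteq> {2..p + q}"
      using mix_part_eq_0[OF p q] by (auto simp: not_less[symmetric])
    then show ?thesis
      by (subst Sum_any.expand_superset[of "{2..p + q}"]) (auto intro: sum.cong)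
  qed
  have "pairing f (mix u v) = (\<Sum>r\<in>{1..2}. \<Sum>s\<in>{1..2}. \<Sum>n\<in>{2..p + q}.
      if even (int n - int r - int s - 1) then pairing f (mix_part r s n u v) else 0)"
    unfolding mix_def any by (simp add: pairing_sum if_distrib[of "pairing f"] cong: if_cong)
  also have "\<dots> = pairing (\<lambda>x. pairing (mixA f x) v) u + pairing (\<lambda>x. pairing (mixB f x) v) u"
  proof -
    have len: "length x + length y + 2 \<le> p + q"
      if "x \<in> Poly_Mapping.keys u" "y \<in> Poly_Mapping.keys v" for x y
      using p q that by fastforce
    show ?thesis
      using pairing_mix_part[of u v "p + q" f, OF len] by (simp only: sum_1_2)
  qed
  finally show ?thesis by (simp add: pairing_fun_add)
qed

definition evalp :: "rat list \<Rightarrow> ab_poly \<Rightarrow> rat" where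
  "evalp xs = pairing (evalq xs)"

lemma evalp_Nil [simp]: "evalp [] u = 0"
  by (simp add: evalp_def pairing_def)

lemma evalp_mix: "evalp xs (mix u v) = evalp xs u * evalp xs v"
  by (simp add: evalp_def pairing_mix mixAB_evalq pairing_fun_mult_left pairing_fun_mult_right)

lemma evalp_interval_transform2: "evalp xs (interval_transform2 u) = evalp (rev xs @ xs) u"
proof -
  have "evalp xs (interval_transform2 u) = pairing (\<lambda>w. evalq xs w + evalq xs (rev w)
      + split_sum (\<lambda>x y. evalq xs (rev x) * evalq xs y) w) u"
    by (simp add: evalp_def interval_transform2_def pairing_lin_ext pairing_add pairing_sweedler
        star_word pairing_mix mixAB_evalq)
  then show ?thesis
    by (simp add: evalp_def evalq_append[abs_def] evalq_rev add_ac)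
qed

section \<open>Injectivity\<close>

lemma split_sum_indicator:
  "split_sum (\<lambda>p q. of_bool (p = replicate k A \<and> q = y)) w
     = (of_bool (w = replicate k A @ A # y) + of_bool (w = replicate k A @ B # y) :: rat)"
proof (induction w arbitrary: k)
  case (Cons l w)
  show ?case
  proof (cases k)
    case 0
    then show ?thesis by (cases l) auto
  next
    case (Suc k')
    then show ?thesis by (cases l) (simp_all add: Cons)
  qed
qed (auto)

text \<open>Words with a \<open>B\<close> are eliminated one \<open>B\<close> at a time, each \<open>B\<close> turning into \<open>A\<close> up to sign.\<close>

lemma eq_0_if_coeffs:
  assumes "\<And>k. Poly_Mapping.lookup u (replicate k A) = 0"
    and *: "\<And>k y. Poly_Mapping.lookup u (replicate k A @ A # y)
            + Poly_Mapping.lookup u (replicate k A @ B # y) = (0 :: rat)"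
  shows "u = 0"
proof (rule poly_mapping_eqI)
  fix w
  show "Poly_Mapping.lookup u w = Poly_Mapping.lookup 0 w"
  proof (induction "count_list w B" arbitrary: w rule: less_induct)
    case less
    have no_B: "x = replicate (length x) A" if "B \<notin> set x" for x
      using that by (metis letter.exhaust replicate_length_same)
    show ?case
    proof (cases "B \<in> set w")
      case False
      then show ?thesis using no_B assms(1) by (metis lookup_zero)
    next
      case True
      then obtain x y where w: "w = x @ B # y" and "B \<notin> set x"
        using split_list_first by fastforce
      with less[of "x @ A # y"] *[of "length x" y] no_B[of x] show ?thesis
        by simp
    qed
  qed
qed

text \<open>The right factors of the coproduct that stand opposite \<open>replicate k A\<close>.
  They multiply \<open>x ^ Suc k\<close> once \<open>x\<close> is put in front of the evaluation
  list.\<close>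

definition strip :: "nat \<Rightarrow> ab_poly \<Rightarrow> ab_poly" where
  "strip k = lin_ext (\<lambda>w. split_sum (\<lambda>p q. if p = replicate k A then word q else 0) w)"

lemma pairing_strip:
  "pairing f (strip k u) = pairing (split_sum (\<lambda>p q. of_bool (p = replicate k A) * f q)) u"
proof -
  have "pairing f (if b then word q else 0) = of_bool b * f q" for b q
    by simp
  then show ?thesis
    unfolding strip_def pairing_lin_ext split_sum_def pairing_sum by presburger
qed

lemma lookup_strip:
  "Poly_Mapping.lookup (strip k u) y
     = Poly_Mapping.lookup u (replicate k A @ A # y) + Poly_Mapping.lookup u (replicate k A @ B # y)"
proof -
  have "Poly_Mapping.lookup (strip k u) y
      = pairing (split_sum (\<lambda>p q. of_bool (p = replicate k A \<and> q = y))) u"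
    by (simp only: pairing_indicator[symmetric] pairing_strip of_bool_conj)
  then show ?thesis
    by (simp add: split_sum_indicator[abs_def] pairing_fun_add pairing_indicator)
qed

lemma eval1_sum:
  assumes "length w < d"
  shows "eval1 x w = (\<Sum>k<d. x ^ Suc k * of_bool (w = replicate k A))"
proof -
  have *: "w = replicate k A \<longleftrightarrow> B \<notin> set w \<and> k = length w" for k
    by (metis letter.exhaust letter.distinct(1) in_set_replicate length_replicate replicate_length_same)
  show ?thesis
  proof (cases "B \<in> set w")
    case True
    then show ?thesis by (simp add: * eval1_def)
  next
    case False
    then have "(\<Sum>k<d. x ^ Suc k * of_bool (w = replicate k A)) = (\<Sum>k<d. if k = length w then x ^ Suc k else 0)"
      by (intro sum.cong) (auto simp: *)
    with False assms show ?thesis by (simp add: eval1_def)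
  qed
qed

lemma evalp_Cons:
  assumes "\<forall>w\<in>Poly_Mapping.keys u. length w < d"
  shows "evalp (x # xs) u = evalp xs u + (\<Sum>k<d. x ^ Suc k *
    (Poly_Mapping.lookup u (replicate k A) + evalp xs (strip k u)))"
proof -
  have 1: "pairing (eval1 x) u = (\<Sum>k<d. x ^ Suc k * Poly_Mapping.lookup u (replicate k A))"
  proof -
    have "pairing (eval1 x) u = pairing (\<lambda>w. \<Sum>k<d. x ^ Suc k * of_bool (w = replicate k A)) u"
      by (rule pairing_cong) (use assms eval1_sum in blast)
    then show ?thesis
      by (simp only: pairing_fun_sum pairing_fun_mult_left pairing_indicator)
  qed
  have 2: "pairing (split_sum (\<lambda>p q. eval1 x p * evalq xs q)) u
      = (\<Sum>k<d. x ^ Suc k * evalp xs (strip k u))"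
  proof -
    have "pairing (split_sum (\<lambda>p q. eval1 x p * evalq xs q)) u
        = pairing (split_sum (\<lambda>p q. \<Sum>k<d. x ^ Suc k * (of_bool (p = replicate k A) * evalq xs q))) u"
    proof (intro pairing_cong split_sum_cong)
      fix w p l q assume "w \<in> Poly_Mapping.keys u" "w = p @ l # q"
      then have "length p < d" using assms by fastforce
      then show "eval1 x p * evalq xs q
          = (\<Sum>k<d. x ^ Suc k * (of_bool (p = replicate k A) * evalq xs q))"
        by (simp only: eval1_sum sum_distrib_right mult.assoc)
    qed
    then show ?thesis
      by (simp only: split_sum_sum[abs_def] pairing_fun_sum split_sum_mult_left[abs_def] pairing_fun_mult_left
          evalp_def pairing_strip)
  qed
  have "evalq (x # xs) = (\<lambda>w. eval1 x w + evalq xs w + split_sum (\<lambda>p q. eval1 x p * evalq xs q) w)"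
    by auto
  then have "evalp (x # xs) u
      = pairing (eval1 x) u + evalp xs u + pairing (split_sum (\<lambda>p q. eval1 x p * evalq xs q)) u"
    by (simp only: evalp_def pairing_fun_add add_ac)
  then show ?thesis
    unfolding 1 2 by (simp add: distrib_left sum.distrib add_ac)
qed

text \<open>Induction on the length bound: as a polynomial in its first variable the evaluation has
  zero coefficients, and these involve \<open>strip k u\<close>, whose words are shorter.\<close>

lemma evalp_eq_0_imp:
  assumes "\<And>xs. evalp xs u = 0"
  shows "u = 0"
proof -
  obtain d where "\<forall>w\<in>Poly_Mapping.keys u. length w < d"
    using finite_nat_set_iff_bounded[of "length ` Poly_Mapping.keys u"] by auto
  then show ?thesis using assms
  proof (induction d arbitrary: u)
    case 0
    then show ?case by auto
  next
    case (Suc d)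
    have coeff_0: "Poly_Mapping.lookup u (replicate k A) + evalp xs (strip k u) = 0" if "k < Suc d" for k xs
    proof -
      define P where "P = (\<Sum>k<Suc d. monom
        (Poly_Mapping.lookup u (replicate k A) + evalp xs (strip k u)) (Suc k))"
      have "poly P x = evalp (x # xs) u - evalp xs u" for x
        unfolding evalp_Cons[OF Suc.prems(1)] P_def
        by (simp only: poly_sum poly_monom) (simp add: mult.commute)
      then have "P = 0" using Suc.prems(2) by (simp add: poly_all_0_iff_0[symmetric])
      then have "coeff P (Suc k) = 0" by simp
      then show ?thesis using that by (simp add: P_def coeff_sum sum.delta del: sum.lessThan_Suc)
    qed
    have out: "Poly_Mapping.lookup u w = 0" if "length w \<ge> Suc d" for w
      using Suc.prems(1) that by (metis in_keys_iff not_less)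
    show ?case
    proof (rule eq_0_if_coeffs)
      fix k
      show lookup_0: "Poly_Mapping.lookup u (replicate k A) = 0" for k
        \<comment> \<open>The empty list removes the \<open>strip\<close> summand.\<close>
        using coeff_0[of k "[]"] out[of "replicate k A"]
        by (cases "k < Suc d") auto
      fix y
      have "strip k u = 0"
      proof (cases "k < Suc d")
        case True
        show ?thesis
        proof (rule Suc.IH)
          show "\<forall>w\<in>Poly_Mapping.keys (strip k u). length w < d"
          proof (rule ballI, rule ccontr)
            fix w assume "w \<in> Poly_Mapping.keys (strip k u)" "\<not> length w < d"
            then show False by (simp add: in_keys_iff lookup_strip out)
          qed
          show "evalp xs (strip k u) = 0" for xs
            using coeff_0[OF True, of xs] lookup_0 by simp
        qed
      next
        case False
        then show ?thesis by (intro poly_mapping_eqI) (simp add: lookup_strip out)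
      qed
      then show "Poly_Mapping.lookup u (replicate k A @ A # y)
          + Poly_Mapping.lookup u (replicate k A @ B # y) = 0"
        by (metis lookup_strip lookup_zero)
    qed
  qed
qed

section \<open>Absence of zero divisors\<close>

lemma poly_split_sum: "poly (split_sum h w) t = split_sum (\<lambda>p q. poly (h p q) t) w"
  by (simp add: split_sum_def poly_sum)

lemma poly_eval1: "poly (eval1 x w) t = eval1 (poly x t) w"
  by (simp add: eval1_def)

lemma poly_evalq: "poly (evalq zs w) t = evalq (map (\<lambda>z. poly z t) zs) w"
  by (induction zs arbitrary: w) (simp_all add: poly_split_sum poly_eval1)

text \<open>\<open>evalq\<close> makes sense over any commutative ring, so a list of polynomials can
  be evaluated first and specialised at \<open>t\<close> afterwards.\<close>

lemma poly_evalp: "\<exists>P. \<forall>t. evalp (map (\<lambda>z. poly z t) zs) u = poly P t"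
proof
  show "\<forall>t. evalp (map (\<lambda>z. poly z t) zs) u
      = poly (\<Sum>w\<in>Poly_Mapping.keys u. smult (Poly_Mapping.lookup u w) (evalq zs w)) t"
    by (simp add: evalp_def pairing_def poly_sum poly_evalq)
qed

text \<open>The exponent in \<open>eval1\<close> is positive even for the empty word.\<close>

lemma evalq_zeros: "evalq (replicate n 0) w = 0"
  by (induction n arbitrary: w) (simp_all add: eval1_def)

lemma evalp_padding: "evalp (xs @ replicate n 0) u = evalp xs u" "evalp (replicate n 0 @ xs) u = evalp xs u"
  by (simp_all add: evalp_def evalq_append[abs_def] evalq_zeros)

text \<open>Two evaluations are joined by a line, along which they are polynomials in one variable.\<close>

lemma mix_nonzero:
  assumes "u \<noteq> 0" "v \<noteq> 0"
  shows "mix u v \<noteq> 0"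
proof -
  obtain xs ys where xs: "evalp xs u \<noteq> 0" and ys: "evalp ys v \<noteq> 0"
    using assms evalp_eq_0_imp by blast
  \<comment> \<open>The entries are t x and (1 - t) y, so up to zero padding t = 1 gives
    \<open>xs\<close> and t = 0 gives \<open>ys\<close>.\<close>
  define zs where "zs = map (\<lambda>x. [:0, x:]) xs @ map (\<lambda>y. [:y, - y:]) ys"
  have zs1: "map (\<lambda>z. poly z 1) zs = xs @ replicate (length ys) 0"
    by (simp add: zs_def map_replicate_const comp_def)
  have zs0: "map (\<lambda>z. poly z 0) zs = replicate (length xs) 0 @ ys"
    by (simp add: zs_def map_replicate_const comp_def)
  obtain P where P: "\<And>t. evalp (map (\<lambda>z. poly z t) zs) u = poly P t"
    using poly_evalp by metis
  obtain Q where Q: "\<And>t. evalp (map (\<lambda>z. poly z t) zs) v = poly Q t"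
    using poly_evalp by metis
  have "P \<noteq> 0" using P[of 1] xs by (auto simp: zs1 evalp_padding)
  moreover have "Q \<noteq> 0" using Q[of 0] ys by (auto simp: zs0 evalp_padding)
  ultimately have "P * Q \<noteq> 0" by simp
  \<comment> \<open>At this single \<open>t\<close> both evaluations are nonzero.\<close>
  then obtain t where "poly (P * Q) t \<noteq> 0" using poly_all_0_iff_0 by blast
  then have "evalp (map (\<lambda>z. poly z t) zs) (mix u v) \<noteq> 0"
    by (simp add: evalp_mix P Q)
  then show ?thesis by (auto simp: evalp_def)
qed

section \<open>From evaluations back to eigenvectors\<close>

lemma evalp_inject:
  assumes "\<And>xs. evalp xs p = evalp xs q"
  shows "p = q"
proof -
  have "evalp xs (p - q) = 0" for xs
    using assms[of xs] by (simp add: evalp_def pairing_diff)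
  then have "p - q = 0"
    by (rule evalp_eq_0_imp)
  then show ?thesis by simp
qed

theorem corollary5p13:
  fixes u\<^sub>1 u\<^sub>2 :: ab_poly and \<mu>\<^sub>1 \<mu>\<^sub>2 :: rat
  assumes "homogeneous u\<^sub>1" and "homogeneous u\<^sub>2"
    and "eigenvector interval_transform2 \<mu>\<^sub>1 u\<^sub>1"
    and "eigenvector interval_transform2 \<mu>\<^sub>2 u\<^sub>2"
  shows "eigenvector interval_transform2 (\<mu>\<^sub>1 * \<mu>\<^sub>2) (mix u\<^sub>1 u\<^sub>2)"
proof -
  have "evalp (rev xs @ xs) u\<^sub>1 = \<mu>\<^sub>1 * evalp xs u\<^sub>1" "evalp (rev xs @ xs) u\<^sub>2 = \<mu>\<^sub>2 * evalp xs u\<^sub>2" for xs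
    using assms(3,4) unfolding eigenvector_def
    by (simp_all add: evalp_interval_transform2[symmetric]) (simp_all add: evalp_def pairing_scale)
  \<comment> \<open>Evaluation is multiplicative for \<open>mix\<close> at
    \<open>rev xs @ xs\<close> as well as at \<open>xs\<close>.\<close>
  then have "evalp xs (interval_transform2 (mix u\<^sub>1 u\<^sub>2)) = \<mu>\<^sub>1 * \<mu>\<^sub>2 * evalp xs (mix u\<^sub>1 u\<^sub>2)" for xs
    by (simp add: evalp_interval_transform2 evalp_mix)
  then have "interval_transform2 (mix u\<^sub>1 u\<^sub>2) = scale (\<mu>\<^sub>1 * \<mu>\<^sub>2) (mix u\<^sub>1 u\<^sub>2)"
    by (intro evalp_inject) (simp add: evalp_def pairing_scale)
  then show ?thesis
    using assms(3,4) by (simp add: eigenvector_def mix_nonzero)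
qed

end
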